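(* Let $m,n\ge 1$ and let $a_1,\ldots,a_m,b_1,\ldots,b_m,c_1,\ldots,c_n,d_1,\ldots,d_n$ be nonnegative integers with $a_i\le b_i$ for $1\le i\le m$, $c_j\le d_j$ for $1\le j\le n$, $b_1\ge b_2\ge\cdots\ge b_m$ and $d_1\ge d_2\ge \cdots\ge d_n$. Suppose that every pair $(P;Q)$ with $P=(p_1,\ldots,p_m)$, $Q=(q_1,\ldots,q_n)$ of integers satisfying $a_i\le p_i\le b_i$ for $1\le i\le m$, $c_j\le q_j\le d_j$ for $1\le j\le n$, and $\sum_{i=1}^m p_i=\sum_{j=1}^n q_j$ is bigraphic. Then $$\sum_{i=1}^k b_i\le \sum_{i=1}^n \min\{c_i,k\}+\Big|\sum_{i=1}^m b_i-\sum_{i=1}^n c_i\Big|\quad\text{for each } k \text{ with } 1\le k\le m,$$ and $$\sum_{i=1}^l d_i\le \sum_{i=1}^m \min\{a_i,l\}+\Big|\sum_{i=1}^n d_i-\sum_{i=1}^m a_i\Big|\quad\text{for each } l \text{ with } 1\le l\le n.$$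
   Context: All graphs are finite, undirected, without loops or parallel edges. A pair $(P;Q)$ of sequences $P=(p_1,\ldots,p_m)$, $Q=(q_1,\ldots,q_n)$ of nonnegative integers is called bigraphic if there is a bipartite graph $G$ with partite sets $X=\{x_1,\ldots,x_m\}$ and $Y=\{y_1,\ldots,y_n\}$ such that $d_G(x_i)=p_i$ for $1\le i\le m$ and $d_G(y_j)=q_j$ for $1\le j\le n$. The data correspond to sequences of integer intervals $L_1=([a_1,b_1],\ldots,[a_m,b_m])$ and $L_2=([c_1,d_1],\ldots,[c_n,d_n])$.
   Formalization: The formal theorem also assumes that at least one pair (P;Q) within the bounds with equal sums exists; without it the claim fails vacuously, e.g. m=n=1, a_1=b_1=5, c_1=d_1=6, where k=1 would give 5 ≤ 2. *)

theory Defs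
  imports Main
begin

definition simple_graph :: "'v set \<Rightarrow> 'v set set \<Rightarrow> bool" where
  "simple_graph V E \<longleftrightarrow> finite V \<and> (\<forall>e\<in>E. e \<subseteq> V \<and> card e = 2)"

definition degree :: "'v set set \<Rightarrow> 'v \<Rightarrow> nat" where
  "degree E v = card {e \<in> E. v \<in> e}"

definition bipartite_graph :: "'v set \<Rightarrow> 'v set \<Rightarrow> 'v set set \<Rightarrow> bool" where
  "bipartite_graph X Y E \<longleftrightarrow>
     simple_graph (X \<union> Y) E \<and> X \<inter> Y = {} \<and> (\<forall>e\<in>E. \<exists>x\<in>X. \<exists>y\<in>Y. e = {x, y})"

text \<open>
  A sequence of length \<open>m\<close> is a function on \<open>nat\<close> of which only the values at \<open>1, \<dots>, m\<close> matter.
  Graphs being finite, taking the vertices from \<open>nat\<close> is no loss of generality.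
\<close>

definition bigraphic :: "nat \<Rightarrow> nat \<Rightarrow> (nat \<Rightarrow> nat) \<Rightarrow> (nat \<Rightarrow> nat) \<Rightarrow> bool" where
  "bigraphic m n p q \<longleftrightarrow>
     (\<exists>(x :: nat \<Rightarrow> nat) (y :: nat \<Rightarrow> nat) E.
        inj_on x {1..m} \<and> inj_on y {1..n} \<and>
        bipartite_graph (x ` {1..m}) (y ` {1..n}) E \<and>
        (\<forall>i\<in>{1..m}. degree E (x i) = p i) \<and>
        (\<forall>j\<in>{1..n}. degree E (y j) = q j))"

definition balanced_selection ::
  "nat \<Rightarrow> nat \<Rightarrow> (nat \<Rightarrow> nat) \<Rightarrow> (nat \<Rightarrow> nat) \<Rightarrow> (nat \<Rightarrow> nat) \<Rightarrow> (nat \<Rightarrow> nat) \<Rightarrow>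
   (nat \<Rightarrow> nat) \<Rightarrow> (nat \<Rightarrow> nat) \<Rightarrow> bool" where
  "balanced_selection m n a b c d p q \<longleftrightarrow>
     (\<forall>i\<in>{1..m}. a i \<le> p i \<and> p i \<le> b i) \<and>
     (\<forall>j\<in>{1..n}. c j \<le> q j \<and> q j \<le> d j) \<and>
     (\<Sum>i=1..m. p i) = (\<Sum>j=1..n. q j)"

end

theory Submission
  imports Defs
begin

text \<open>
  Every balanced selection \<open>(p; q)\<close>, of total \<open>s\<close> say, already gives both inequalities.  Counting
  edges between the first \<open>k\<close> vertices of \<open>X\<close> and \<open>Y\<close> gives
  \<open>p\<^sub>1 + \<dots> + p\<^sub>k \<le> \<Sum>\<^sub>j min q\<^sub>j k\<close>.  Replacing \<open>p\<close> by \<open>b\<close> raises the left side by at most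
  \<open>\<Sum>b - s\<close>, and replacing \<open>q\<close> by \<open>c\<close> lowers the right side by at most \<open>s - \<Sum>c\<close>; the two errors
  add up to \<open>\<Sum>b - \<Sum>c\<close>, whatever \<open>s\<close> is.
\<close>

lemma bipartite_graph_commute: "bipartite_graph X Y E \<Longrightarrow> bipartite_graph Y X E"
  unfolding bipartite_graph_def by (metis Int_commute Un_commute insert_commute)

text \<open>Since \<open>X\<close> and \<open>Y\<close> are disjoint, an edge at \<open>v\<close>
  has its other end in \<open>Y\<close>, and that end determines the edge.\<close>

lemma degree_bipartite:
  assumes "bipartite_graph X Y E" and "v \<in> X"
  shows "degree E v = card {w \<in> Y. {v, w} \<in> E}"
proof -
  have "{e \<in> E. v \<in> e} = (\<lambda>w. {v, w}) ` {w \<in> Y. {v, w} \<in> E}"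
    using assms unfolding bipartite_graph_def by fastforce
  moreover have "inj_on (\<lambda>w. {v, w}) {w \<in> Y. {v, w} \<in> E}"
    by (auto simp: inj_on_def doubleton_eq_iff)
  ultimately show ?thesis
    by (simp add: degree_def card_image)
qed

text \<open>A vertex \<open>w\<close> of \<open>Y\<close> has at most \<open>card S\<close>
  neighbours in \<open>S\<close>, and at most \<open>degree E w\<close> neighbours in all.\<close>

lemma sum_degree_le_sum_min:
  assumes G: "bipartite_graph X Y E" and S: "S \<subseteq> X"
  shows "(\<Sum>v\<in>S. degree E v) \<le> (\<Sum>w\<in>Y. min (degree E w) (card S))"
proof -
  have fin: "finite X" "finite Y" "finite S"
    using G S finite_subset by (auto simp: bipartite_graph_def simple_graph_def)
  have "(\<Sum>v\<in>S. degree E v) = (\<Sum>v\<in>S. card {w \<in> Y. {v, w} \<in> E})"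
    using degree_bipartite[OF G] S by (intro sum.cong) auto
  \<comment> \<open>Double counting: summing the constant 1 over adjacent pairs in either
    order.\<close>
  also have "\<dots> = (\<Sum>w\<in>Y. card {v \<in> S. {v, w} \<in> E})"
    using sum.swap_restrict[OF fin(3,2), of "\<lambda>_ _. 1::nat" "\<lambda>v w. {v, w} \<in> E"] by simp
  also have "\<dots> \<le> (\<Sum>w\<in>Y. min (degree E w) (card S))"
  proof (intro sum_mono min.boundedI)
    fix w assume "w \<in> Y"
    then have "degree E w = card {v \<in> X. {v, w} \<in> E}"
      using degree_bipartite[OF bipartite_graph_commute[OF G]] by (simp add: insert_commute)
    then show "card {v \<in> S. {v, w} \<in> E} \<le> degree E w"
      using S fin by (auto intro!: card_mono)
    show "card {v \<in> S. {v, w} \<in> E} \<le> card S"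
      using fin by (auto intro!: card_mono)
  qed
  finally show ?thesis .
qed

lemma bigraphic_commute: "bigraphic m n p q \<Longrightarrow> bigraphic n m q p"
  unfolding bigraphic_def using bipartite_graph_commute by blast

lemma bigraphic_sum_le_sum_min:
  assumes "bigraphic m n p q" and "k \<le> m"
  shows "(\<Sum>i=1..k. p i) \<le> (\<Sum>j=1..n. min (q j) k)"
proof -
  obtain x y :: "nat \<Rightarrow> nat" and E where x: "inj_on x {1..m}" and y: "inj_on y {1..n}"
    and G: "bipartite_graph (x ` {1..m}) (y ` {1..n}) E"
    and p: "\<forall>i\<in>{1..m}. degree E (x i) = p i" and q: "\<forall>j\<in>{1..n}. degree E (y j) = q j"
    using assms(1) unfolding bigraphic_def by blast
  have sub: "{1..k} \<subseteq> {1..m}" using assms(2) by auto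
  have xk: "inj_on x {1..k}" using x sub by (rule inj_on_subset)
  have "(\<Sum>i=1..k. p i) = (\<Sum>v\<in>x ` {1..k}. degree E v)"
    unfolding sum.reindex[OF xk] using p sub by (intro sum.cong) auto
  also have "\<dots> \<le> (\<Sum>w\<in>y ` {1..n}. min (degree E w) (card (x ` {1..k})))"
    using sub by (intro sum_degree_le_sum_min[OF G]) auto
  also have "\<dots> = (\<Sum>j=1..n. min (q j) k)"
    unfolding sum.reindex[OF y] card_image[OF xk] using q by (intro sum.cong) auto
  finally show ?thesis .
qed

lemma balanced_selection_commute:
  "balanced_selection m n a b c d p q \<Longrightarrow> balanced_selection n m c d a b q p"
  unfolding balanced_selection_def by simp

lemma sum_upper_bounds_le:
  assumes bal: "balanced_selection m n a b c d p q" and big: "bigraphic m n p q" and k: "k \<le> m"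
  shows "int (\<Sum>i=1..k. b i)
    \<le> int (\<Sum>j=1..n. min (c j) k) + \<bar>int (\<Sum>i=1..m. b i) - int (\<Sum>j=1..n. c j)\<bar>"
proof -
  have pb: "p i \<le> b i" if "i \<in> {1..m}" for i
    using bal that by (simp add: balanced_selection_def)
  have cq: "c j \<le> q j" if "j \<in> {1..n}" for j
    using bal that by (simp add: balanced_selection_def)
  have split: "(\<Sum>i=1..m. f i) = (\<Sum>i=1..k. f i) + (\<Sum>i=k+1..m. f i)" for f :: "nat \<Rightarrow> nat"
    using sum.ub_add_nat[of 1 k f "m - k"] k by simp
  \<comment> \<open>The gap between \<open>b\<close> and \<open>p\<close> on the first
    \<open>k\<close> indices is at most the total gap, as the tail adds a nonnegative amount. Both
    estimates are kept additive to avoid truncated subtraction.\<close>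
  have "(\<Sum>i=k+1..m. p i) \<le> (\<Sum>i=k+1..m. b i)"
    by (intro sum_mono pb) auto
  then have "(\<Sum>i=1..k. b i) + (\<Sum>i=1..m. p i) \<le> (\<Sum>i=1..k. p i) + (\<Sum>i=1..m. b i)"
    unfolding split by simp
  moreover have "(\<Sum>i=1..k. p i) \<le> (\<Sum>j=1..n. min (q j) k)"
    using big k by (rule bigraphic_sum_le_sum_min)
  \<comment> \<open>Termwise, raising \<open>c j\<close> to \<open>q j\<close> raises its minimum
    with \<open>k\<close> by at most \<open>q j - c j\<close>.\<close>
  moreover have "(\<Sum>j=1..n. min (q j) k) + (\<Sum>j=1..n. c j)
      \<le> (\<Sum>j=1..n. min (c j) k) + (\<Sum>j=1..n. q j)"
    unfolding sum.distrib[symmetric]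
  proof (rule sum_mono)
    fix j assume "j \<in> {1..n}"
    then show "min (q j) k + c j \<le> min (c j) k + q j" using cq[of j] by linarith
  qed
  moreover have "(\<Sum>i=1..m. p i) = (\<Sum>j=1..n. q j)"
    using bal by (simp add: balanced_selection_def)
  ultimately show ?thesis by linarith
qed

theorem theorem1p4:
  fixes m n :: nat and a b c d :: "nat \<Rightarrow> nat"
  assumes "1 \<le> m" and "1 \<le> n"
    and "\<forall>i\<in>{1..m}. a i \<le> b i"
    and "\<forall>j\<in>{1..n}. c j \<le> d j"
    and "antimono_on {1..m} b"
    and "antimono_on {1..n} d"
    and "\<exists>p q. balanced_selection m n a b c d p q"
    and "\<forall>p q. balanced_selection m n a b c d p q \<longrightarrow> bigraphic m n p q"
  shows "(\<forall>k\<in>{1..m}.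
            int (\<Sum>i=1..k. b i)
              \<le> int (\<Sum>i=1..n. min (c i) k) + \<bar>int (\<Sum>i=1..m. b i) - int (\<Sum>i=1..n. c i)\<bar>) \<and>
         (\<forall>l\<in>{1..n}.
            int (\<Sum>i=1..l. d i)
              \<le> int (\<Sum>i=1..m. min (a i) l) + \<bar>int (\<Sum>i=1..n. d i) - int (\<Sum>i=1..m. a i)\<bar>)"
proof -
  \<comment> \<open>Existence matters: for \<open>m = n = 1\<close>, \<open>a = b = 9\<close>,
    \<open>c = d = 10\<close> no selection is balanced, and the first inequality fails.\<close>
  obtain p q where bal: "balanced_selection m n a b c d p q" and big: "bigraphic m n p q"
    using assms(7,8) by blast
  show ?thesis
    \<comment> \<open>The second inequality is the first with the two sides of the graph
      exchanged.\<close>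
    using sum_upper_bounds_le[OF bal big]
      sum_upper_bounds_le[OF balanced_selection_commute[OF bal] bigraphic_commute[OF big]]
    by simp
qed

end
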